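(* Let $(X,\tau)$ be a monotone convergence space. Then the core compactly generated topology $\mathcal{C}X$ of $X$ is contained in the Scott topology of $X$ under the specialization order of $(X,\tau)$.
   Context: The specialization order of a $T_0$ space is $x\le y$ iff $x\in \mathrm{cl}(\{y\})$. A $T_0$ space is a monotone convergence space if the closure of every subset that is directed in the specialization order is the closure of a unique point. A subset $U$ of a poset is Scott open if it is an upper set and every directed $D$ whose supremum exists and lies in $U$ meets $U$; these sets form the Scott topology. A topological space $C$ is core compact if its lattice $\mathcal{O}(C)$ of open sets is a continuous lattice, i.e. for every open $U$ and $x\in U$ there is an open $V$ with $x\in V\ll U$, where $V\ll U$ means that every directed family of open sets whose union contains $U$ has a member containing $V$. For a topological space $(X,\tau)$, a subset $V\subseteq X$ is open in the core compactly generated topology $\mathcal{C}X$ if $\rho^{-1}(V)$ is open in $C$ for every core compact space $C$ and every continuous map $\rho:C\to (X,\tau)$. *)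

theory Defs
  imports "HOL-Analysis.Analysis"
begin

definition directed_set :: "('a \<Rightarrow> 'a \<Rightarrow> bool) \<Rightarrow> 'a set \<Rightarrow> bool" where
  "directed_set le D \<longleftrightarrow> D \<noteq> {} \<and> (\<forall>x\<in>D. \<forall>y\<in>D. \<exists>z\<in>D. le x z \<and> le y z)"

definition is_supremum :: "'a set \<Rightarrow> ('a \<Rightarrow> 'a \<Rightarrow> bool) \<Rightarrow> 'a set \<Rightarrow> 'a \<Rightarrow> bool" where
  "is_supremum P le D s \<longleftrightarrow>
     s \<in> P \<and> (\<forall>d\<in>D. le d s) \<and> (\<forall>u\<in>P. (\<forall>d\<in>D. le d u) \<longrightarrow> le s u)"

definition scott_open :: "'a set \<Rightarrow> ('a \<Rightarrow> 'a \<Rightarrow> bool) \<Rightarrow> 'a set \<Rightarrow> bool" where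
  "scott_open P le U \<longleftrightarrow>
     U \<subseteq> P \<and>
     (\<forall>x\<in>U. \<forall>y\<in>P. le x y \<longrightarrow> y \<in> U) \<and>
     (\<forall>D s. D \<subseteq> P \<and> directed_set le D \<and> is_supremum P le D s \<and> s \<in> U \<longrightarrow> D \<inter> U \<noteq> {})"

definition scott_topology :: "'a set \<Rightarrow> ('a \<Rightarrow> 'a \<Rightarrow> bool) \<Rightarrow> 'a topology" where
  "scott_topology P le = topology (scott_open P le)"

lemma scott_open_upper:
  assumes "scott_open P le U" "x \<in> U" "y \<in> P" "le x y"
  shows "y \<in> U"
  using assms unfolding scott_open_def by metis

lemma scott_open_meets:
  assumes "scott_open P le U" "D \<subseteq> P" "directed_set le D" "is_supremum P le D s" "s \<in> U"
  shows "D \<inter> U \<noteq> {}"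
  using assms unfolding scott_open_def by metis

lemma istopology_scott_open: "istopology (scott_open P le)"
  unfolding istopology_def
proof (intro conjI allI impI)
  fix S T
  assume S: "scott_open P le S" and T: "scott_open P le T"
  show "scott_open P le (S \<inter> T)"
    unfolding scott_open_def
  proof (intro conjI ballI allI impI)
    show "S \<inter> T \<subseteq> P"
      using S by (auto simp: scott_open_def)
  next
    fix x y
    assume "x \<in> S \<inter> T" "y \<in> P" "le x y"
    then show "y \<in> S \<inter> T"
      using scott_open_upper[OF S, of x y] scott_open_upper[OF T, of x y] by simp
  next
    fix D s
    assume D: "D \<subseteq> P \<and> directed_set le D \<and> is_supremum P le D s \<and> s \<in> S \<inter> T"
    have "D \<inter> S \<noteq> {}"
      by (rule scott_open_meets[OF S]) (use D in auto)
    moreover have "D \<inter> T \<noteq> {}"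
      by (rule scott_open_meets[OF T]) (use D in auto)
    ultimately obtain d e where "d \<in> D" "d \<in> S" "e \<in> D" "e \<in> T"
      by auto
    have "directed_set le D"
      using D by simp
    then obtain z where z: "z \<in> D" "le d z" "le e z"
      using \<open>d \<in> D\<close> \<open>e \<in> D\<close> unfolding directed_set_def by metis
    have "z \<in> P"
      using D z(1) by auto
    have "z \<in> S"
      using scott_open_upper[OF S \<open>d \<in> S\<close> \<open>z \<in> P\<close> z(2)] .
    moreover have "z \<in> T"
      using scott_open_upper[OF T \<open>e \<in> T\<close> \<open>z \<in> P\<close> z(3)] .
    ultimately have "z \<in> D \<inter> (S \<inter> T)"
      using z(1) by simp
    then show "D \<inter> (S \<inter> T) \<noteq> {}"
      by auto
  qed
next
  fix \<K>
  assume K: "\<forall>K\<in>\<K>. scott_open P le K"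
  show "scott_open P le (\<Union>\<K>)"
    unfolding scott_open_def
  proof (intro conjI ballI allI impI)
    show "\<Union>\<K> \<subseteq> P"
      using K by (auto simp: scott_open_def)
  next
    fix x y
    assume "x \<in> \<Union>\<K>" "y \<in> P" "le x y"
    then show "y \<in> \<Union>\<K>"
      using K by (auto simp: scott_open_def)
  next
    fix D s
    assume D: "D \<subseteq> P \<and> directed_set le D \<and> is_supremum P le D s \<and> s \<in> \<Union>\<K>"
    then obtain K where "K \<in> \<K>" "s \<in> K"
      by auto
    then have "D \<inter> K \<noteq> {}"
      using K D scott_open_meets[of P le K D s] by simp
    then show "D \<inter> \<Union>\<K> \<noteq> {}"
      using \<open>K \<in> \<K>\<close> by auto
  qed
qed

lemma openin_scott_topology: "openin (scott_topology P le) U \<longleftrightarrow> scott_open P le U"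
  by (simp add: scott_topology_def istopology_scott_open topology_inverse')

text \<open>The closure operator of the library ignores points outside the carrier, so
  \<open>specialization X x y\<close> entails that both points lie in \<open>topspace X\<close>.\<close>

definition specialization :: "'a topology \<Rightarrow> 'a \<Rightarrow> 'a \<Rightarrow> bool" where
  "specialization X x y \<longleftrightarrow> x \<in> X closure_of {y}"

lemma specialization_in_topspace:
  "specialization X x y \<Longrightarrow> x \<in> topspace X \<and> y \<in> topspace X"
  by (auto simp: specialization_def in_closure_of)

definition monotone_convergence_space :: "'a topology \<Rightarrow> bool" where
  "monotone_convergence_space X \<longleftrightarrow>
     t0_space X \<and>
     (\<forall>D. D \<subseteq> topspace X \<and> directed_set (specialization X) D \<longrightarrow>
        (\<exists>!x. x \<in> topspace X \<and> X closure_of D = X closure_of {x}))"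

definition way_below_open :: "'a topology \<Rightarrow> 'a set \<Rightarrow> 'a set \<Rightarrow> bool" where
  "way_below_open C V U \<longleftrightarrow>
     (\<forall>\<F>. (\<forall>W\<in>\<F>. openin C W) \<and> directed_set (\<subseteq>) \<F> \<and> U \<subseteq> \<Union>\<F> \<longrightarrow> (\<exists>W\<in>\<F>. V \<subseteq> W))"

definition core_compact_space :: "'a topology \<Rightarrow> bool" where
  "core_compact_space C \<longleftrightarrow>
     (\<forall>U x. openin C U \<and> x \<in> U \<longrightarrow> (\<exists>V. openin C V \<and> x \<in> V \<and> way_below_open C V U))"

text \<open>A formula cannot quantify over the spaces of all types, so the core compact test
  spaces are taken from the topologies (with arbitrary carrier) on a type \<open>'c\<close>, which
  is a parameter playing the role of the universe of test spaces.  Universes \<open>'a + 'c\<close>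
  with \<open>'c\<close> arbitrary hold a homeomorphic copy of every space on \<open>'c\<close> and of every
  subset of the space \<open>X\<close> on \<open>'a\<close> itself; a smaller universe such as \<open>unit\<close> may have
  too few test spaces to detect anything.\<close>

definition core_compactly_generated_open :: "'c itself \<Rightarrow> 'a topology \<Rightarrow> 'a set \<Rightarrow> bool" where
  "core_compactly_generated_open _ X V \<longleftrightarrow>
     V \<subseteq> topspace X \<and>
     (\<forall>(C :: 'c topology) \<rho>. core_compact_space C \<and> continuous_map C X \<rho> \<longrightarrow>
        openin C {c \<in> topspace C. \<rho> c \<in> V})"

definition core_compactly_generated :: "'c itself \<Rightarrow> 'a topology \<Rightarrow> 'a topology" where
  "core_compactly_generated T X = topology (core_compactly_generated_open T X)"

lemma istopology_core_compactly_generated_open: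
  "istopology (core_compactly_generated_open (T :: 'c itself) X)"
  unfolding istopology_def
proof (intro conjI allI impI)
  fix S S'
  assume S: "core_compactly_generated_open T X S" "core_compactly_generated_open T X S'"
  show "core_compactly_generated_open T X (S \<inter> S')"
    unfolding core_compactly_generated_open_def
  proof (intro conjI allI impI)
    show "S \<inter> S' \<subseteq> topspace X"
      using S(1) by (auto simp: core_compactly_generated_open_def)
    fix C :: "'c topology" and \<rho>
    assume C: "core_compact_space C \<and> continuous_map C X \<rho>"
    have "openin C {c \<in> topspace C. \<rho> c \<in> S}" "openin C {c \<in> topspace C. \<rho> c \<in> S'}"
      using S C by (simp_all add: core_compactly_generated_open_def)
    then have "openin C ({c \<in> topspace C. \<rho> c \<in> S} \<inter> {c \<in> topspace C. \<rho> c \<in> S'})"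
      by (rule openin_Int)
    also have "{c \<in> topspace C. \<rho> c \<in> S} \<inter> {c \<in> topspace C. \<rho> c \<in> S'} =
        {c \<in> topspace C. \<rho> c \<in> S \<inter> S'}"
      by auto
    finally show "openin C {c \<in> topspace C. \<rho> c \<in> S \<inter> S'}" .
  qed
next
  fix \<K>
  assume K: "\<forall>K\<in>\<K>. core_compactly_generated_open T X K"
  show "core_compactly_generated_open T X (\<Union>\<K>)"
    unfolding core_compactly_generated_open_def
  proof (intro conjI allI impI)
    show "\<Union>\<K> \<subseteq> topspace X"
      using K by (auto simp: core_compactly_generated_open_def)
    fix C :: "'c topology" and \<rho>
    assume C: "core_compact_space C \<and> continuous_map C X \<rho>"
    have "openin C (\<Union>K\<in>\<K>. {c \<in> topspace C. \<rho> c \<in> K})"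
      using K C by (intro openin_Union ballI) (auto simp: core_compactly_generated_open_def)
    also have "(\<Union>K\<in>\<K>. {c \<in> topspace C. \<rho> c \<in> K}) = {c \<in> topspace C. \<rho> c \<in> \<Union>\<K>}"
      by auto
    finally show "openin C {c \<in> topspace C. \<rho> c \<in> \<Union>\<K>}" .
  qed
qed

lemma openin_core_compactly_generated:
  "openin (core_compactly_generated T X) V \<longleftrightarrow> core_compactly_generated_open T X V"
  by (simp add: core_compactly_generated_def istopology_core_compactly_generated_open
      topology_inverse')

end

theory Submission
  imports Defs
begin

text \<open>A directed set \<open>D\<close> with a new top point \<open>\<infinity>\<close> adjoined is core compact in the topology
  whose nonempty open sets are the upper sets that contain \<open>\<infinity>\<close> and meet \<open>D\<close>: every point has a
  neighbourhood base of principal filters \<open>\<up>d\<close> with \<open>d \<in> D\<close>, which are compact because they have a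
  least element.  In a monotone convergence space a supremum \<open>s\<close> of \<open>D\<close> lies in the closure of \<open>D\<close>,
  so the inclusion of \<open>D\<close> extended by \<open>\<infinity> \<mapsto> s\<close> is continuous.  Pulling back an open set
  \<open>V\<close> of the core compactly generated topology with \<open>s \<in> V\<close> shows that \<open>V\<close> meets \<open>D\<close>; the
  directed sets \<open>{x, y}\<close> with \<open>x \<le> y\<close> show that \<open>V\<close> is an upper set.\<close>

text \<open>The sum type keeps the new point \<open>Inr t\<close> apart from \<open>D\<close> and
  puts the space into the universe \<open>'a + 'c\<close> of test spaces. The last clause keeps
  \<open>Inr t\<close> from being isolated: its neighbourhoods reach into \<open>D\<close>.\<close>

definition adjoin_top_open :: "('a \<Rightarrow> 'a \<Rightarrow> bool) \<Rightarrow> 'a set \<Rightarrow> 'b \<Rightarrow> ('a + 'b) set \<Rightarrow> bool" where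
  "adjoin_top_open le D t W \<longleftrightarrow>
     W \<subseteq> insert (Inr t) (Inl ` D) \<and>
     (\<forall>x y. Inl x \<in> W \<and> y \<in> D \<and> le x y \<longrightarrow> Inl y \<in> W) \<and>
     (W \<noteq> {} \<longrightarrow> Inr t \<in> W \<and> (\<exists>d. Inl d \<in> W))"

definition adjoin_top :: "('a \<Rightarrow> 'a \<Rightarrow> bool) \<Rightarrow> 'a set \<Rightarrow> 'b \<Rightarrow> ('a + 'b) topology" where
  "adjoin_top le D t = topology (adjoin_top_open le D t)"

lemma openin_adjoin_top:
  assumes "directed_set le D"
  shows "openin (adjoin_top le D t) W \<longleftrightarrow> adjoin_top_open le D t W"
proof -
  have "istopology (adjoin_top_open le D t)"
    unfolding istopology_def
  proof (intro conjI allI impI)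
    fix S T
    assume S: "adjoin_top_open le D t S" and T: "adjoin_top_open le D t T"
    \<comment> \<open>Directedness makes intersections open: a bound \<open>z\<close> in
      \<open>D\<close> of one point from each set lies in both, as both are upper sets.\<close>
    have "\<exists>d. Inl d \<in> S \<inter> T" if ne: "S \<inter> T \<noteq> {}"
    proof -
      obtain d e where de: "Inl d \<in> S" "Inl e \<in> T"
        using S T ne unfolding adjoin_top_open_def by blast
      then have "d \<in> D" "e \<in> D"
        using S T unfolding adjoin_top_open_def by blast+
      then obtain z where "z \<in> D" "le d z" "le e z"
        using assms unfolding directed_set_def by blast
      then show ?thesis
        using S T de unfolding adjoin_top_open_def by blast
    qed
    then show "adjoin_top_open le D t (S \<inter> T)"
      using S T unfolding adjoin_top_open_def by blast
  next
    fix \<K>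
    assume K: "\<forall>K\<in>\<K>. adjoin_top_open le D t K"
    show "adjoin_top_open le D t (\<Union>\<K>)"
      unfolding adjoin_top_open_def
    proof (intro conjI allI impI)
      show "\<Union>\<K> \<subseteq> insert (Inr t) (Inl ` D)"
        using K by (intro Union_least) (simp add: adjoin_top_open_def)
    next
      fix x y
      assume "Inl x \<in> \<Union>\<K> \<and> y \<in> D \<and> le x y"
      then obtain L where L: "L \<in> \<K>" "Inl x \<in> L" "y \<in> D" "le x y"
        by blast
      then have "Inl y \<in> L"
        using K unfolding adjoin_top_open_def by metis
      then show "Inl y \<in> \<Union>\<K>"
        using L by blast
    next
      assume "\<Union>\<K> \<noteq> {}"
      then obtain L where L: "L \<in> \<K>" "L \<noteq> {}"
        by blast
      then have "Inr t \<in> L" "\<exists>d. Inl d \<in> L"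
        using K unfolding adjoin_top_open_def by metis+
      then show "Inr t \<in> \<Union>\<K>" "\<exists>d. Inl d \<in> \<Union>\<K>"
        using L by blast+
    qed
  qed
  then show ?thesis
    by (simp add: adjoin_top_def topology_inverse')
qed

lemma topspace_adjoin_top:
  assumes "directed_set le D"
  shows "topspace (adjoin_top le D t) = insert (Inr t) (Inl ` D)"
proof (rule subset_antisym)
  show "topspace (adjoin_top le D t) \<subseteq> insert (Inr t) (Inl ` D)"
    using openin_topspace[of "adjoin_top le D t"]
    unfolding openin_adjoin_top[OF assms] adjoin_top_open_def by blast
  have "adjoin_top_open le D t (insert (Inr t) (Inl ` D))"
    using assms by (auto simp: adjoin_top_open_def directed_set_def)
  then show "insert (Inr t) (Inl ` D) \<subseteq> topspace (adjoin_top le D t)"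
    unfolding openin_adjoin_top[OF assms, symmetric] by (rule openin_subset)
qed

lemma core_compact_adjoin_top:
  assumes dir: "directed_set le D"
    and refl: "\<And>x. x \<in> D \<Longrightarrow> le x x"
    and trans: "\<And>x y z. le x y \<Longrightarrow> le y z \<Longrightarrow> le x z"
  shows "core_compact_space (adjoin_top le D t)"
  unfolding core_compact_space_def
proof (intro allI impI)
  fix U x
  assume "openin (adjoin_top le D t) U \<and> x \<in> U"
  then have U: "adjoin_top_open le D t U" and x: "x \<in> U"
    by (simp_all add: openin_adjoin_top[OF dir])
  \<comment> \<open>For \<open>x = Inr t\<close> the last clause of openness of \<open>U\<close>
    supplies \<open>d\<close>, so one filter \<open>V\<close> serves both kinds of points.\<close>
  obtain d where d: "Inl d \<in> U" "x = Inl d \<or> x = Inr t"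
    using U x unfolding adjoin_top_open_def by blast
  then have "d \<in> D"
    using U unfolding adjoin_top_open_def by blast
  define V :: "('a + 'b) set" where "V = insert (Inr t) (Inl ` {e \<in> D. le d e})"
  have "adjoin_top_open le D t V"
    unfolding adjoin_top_open_def
  proof (intro conjI allI impI)
    show "V \<subseteq> insert (Inr t) (Inl ` D)"
      by (auto simp: V_def)
  next
    fix y z
    assume "Inl y \<in> V \<and> z \<in> D \<and> le y z"
    then show "Inl z \<in> V"
      using trans[of d y z] by (auto simp: V_def)
  next
    show "Inr t \<in> V" "\<exists>e. Inl e \<in> V"
      using refl \<open>d \<in> D\<close> by (auto simp: V_def)
  qed
  moreover have "x \<in> V"
    using d refl \<open>d \<in> D\<close> by (auto simp: V_def)
  moreover have "way_below_open (adjoin_top le D t) V U"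
    unfolding way_below_open_def
  proof (intro allI impI)
    fix \<F>
    assume F: "(\<forall>W\<in>\<F>. openin (adjoin_top le D t) W) \<and> directed_set (\<subseteq>) \<F> \<and> U \<subseteq> \<Union>\<F>"
    then obtain W where W: "W \<in> \<F>" "Inl d \<in> W"
      using d by blast
    then have "adjoin_top_open le D t W"
      using F by (simp add: openin_adjoin_top[OF dir])
    \<comment> \<open>Being nonempty, \<open>W\<close> contains \<open>Inr t\<close>; being an upper
      set, it contains the filter generated by \<open>d\<close>.\<close>
    then have "V \<subseteq> W"
      using W unfolding V_def adjoin_top_open_def by blast
    then show "\<exists>W\<in>\<F>. V \<subseteq> W"
      using W by blast
  qed
  ultimately show "\<exists>V. openin (adjoin_top le D t) V \<and> x \<in> V \<and> way_below_open (adjoin_top le D t) V U"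
    by (auto simp: openin_adjoin_top[OF dir])
qed

lemma specialization_refl: "x \<in> topspace X \<Longrightarrow> specialization X x x"
  by (simp add: specialization_def in_closure_of)

lemma specialization_openin:
  "specialization X x y \<Longrightarrow> openin X U \<Longrightarrow> x \<in> U \<Longrightarrow> y \<in> U"
  by (auto simp: specialization_def in_closure_of)

lemma specialization_trans:
  assumes "specialization X x y" "specialization X y z"
  shows "specialization X x z"
  using assms unfolding specialization_def in_closure_of by blast

text \<open>Since \<open>s\<close> is in the closure of \<open>D\<close>, an open set around
  \<open>s\<close> meets \<open>D\<close>; since \<open>s\<close> bounds \<open>D\<close>, an open
  set meeting \<open>D\<close> contains \<open>s\<close>. Together these give the last clause for
  preimages.\<close>

lemma continuous_map_adjoin_top:
  assumes dir: "directed_set (specialization X) D" and D: "D \<subseteq> topspace X"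
    and ub: "\<And>d. d \<in> D \<Longrightarrow> specialization X d s" and s: "s \<in> X closure_of D"
  shows "continuous_map (adjoin_top (specialization X) D t) X (case_sum id (\<lambda>_. s))"
  unfolding continuous_map_def
proof (intro conjI allI impI)
  show "case_sum id (\<lambda>_. s) \<in> topspace (adjoin_top (specialization X) D t) \<rightarrow> topspace X"
    using D s by (auto simp: topspace_adjoin_top[OF dir] in_closure_of)
next
  fix U
  assume U: "openin X U"
  have "\<exists>d\<in>D. d \<in> U" if "s \<in> U"
    using s U that by (auto simp: in_closure_of)
  moreover have "s \<in> U" if "d \<in> D" "d \<in> U" for d
    using specialization_openin[OF ub[OF that(1)] U that(2)] .
  ultimately show "openin (adjoin_top (specialization X) D t)
      {c \<in> topspace (adjoin_top (specialization X) D t). case_sum id (\<lambda>_. s) c \<in> U}"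
    using specialization_openin[OF _ U]
    unfolding openin_adjoin_top[OF dir] topspace_adjoin_top[OF dir] adjoin_top_open_def
    by (auto simp: image_iff)
qed

text \<open>This applies the test space to \<open>V\<close>. The conclusion unfolds openness so that
  its upper-set clause and its last clause can each be used directly.\<close>

lemma adjoin_top_open_vimage:
  fixes X :: "'a topology" and t :: 'c
  assumes V: "core_compactly_generated_open TYPE('a + 'c) X V"
    and dir: "directed_set (specialization X) D" and D: "D \<subseteq> topspace X"
    and ub: "\<And>d. d \<in> D \<Longrightarrow> specialization X d s" and s: "s \<in> X closure_of D"
  shows "adjoin_top_open (specialization X) D t
      {c \<in> insert (Inr t) (Inl ` D). case_sum id (\<lambda>_. s) c \<in> V}"
proof -
  let ?C = "adjoin_top (specialization X) D t"
  have "core_compact_space ?C"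
    using D by (intro core_compact_adjoin_top[OF dir])
      (auto intro: specialization_refl specialization_trans)
  moreover have "continuous_map ?C X (case_sum id (\<lambda>_. s))"
    using continuous_map_adjoin_top[OF dir D ub s] .
  ultimately have "openin ?C {c \<in> topspace ?C. case_sum id (\<lambda>_. s) c \<in> V}"
    using V unfolding core_compactly_generated_open_def by blast
  then show ?thesis
    by (simp add: openin_adjoin_top[OF dir] topspace_adjoin_top[OF dir])
qed

lemma core_compactly_generated_open_upper:
  fixes X :: "'a topology"
  assumes V: "core_compactly_generated_open TYPE('a + 'c) X V"
    and xy: "x \<in> V" "specialization X x y"
  shows "y \<in> V"
proof -
  let ?D = "{x, y}"
  have D: "?D \<subseteq> topspace X"
    using specialization_in_topspace[OF xy(2)] by simp
  then have refl: "specialization X x x" "specialization X y y"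
    by (simp_all add: specialization_refl)
  have "directed_set (specialization X) ?D"
    using xy refl by (auto simp: directed_set_def)
  moreover have "y \<in> X closure_of ?D"
    using closure_of_subset[OF D] by blast
  \<comment> \<open>The new point is mapped to \<open>y\<close>, and \<open>undefined\<close> is an
    arbitrary label for it. The preimage contains \<open>Inl x\<close>, so the upper-set clause
    gives \<open>Inl y\<close>.\<close>
  ultimately have "adjoin_top_open (specialization X) ?D (undefined :: 'c)
      {c \<in> insert (Inr undefined) (Inl ` ?D). case_sum id (\<lambda>_. y) c \<in> V}"
    using xy refl by (intro adjoin_top_open_vimage[OF V _ D]) auto
  then show ?thesis
    using xy unfolding adjoin_top_open_def by force
qed

text \<open>Monotone convergence turns the order-theoretic supremum into a topological limit: the
  point \<open>x\<close> whose closure is that of \<open>D\<close> bounds \<open>D\<close>, so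
  \<open>s\<close> lies below \<open>x\<close>, that is, in the closure of
  \<open>{x}\<close>.\<close>

lemma supremum_in_closure_of:
  assumes "monotone_convergence_space X"
    and D: "D \<subseteq> topspace X" "directed_set (specialization X) D"
    and s: "is_supremum (topspace X) (specialization X) D s"
  shows "s \<in> X closure_of D"
proof -
  obtain x where x: "x \<in> topspace X" "X closure_of D = X closure_of {x}"
    using assms unfolding monotone_convergence_space_def by blast
  then have "specialization X d x" if "d \<in> D" for d
    using that closure_of_subset[OF D(1)] by (auto simp: specialization_def)
  then have "specialization X s x"
    using s x(1) unfolding is_supremum_def by blast
  then show ?thesis
    by (simp add: specialization_def x(2))
qed

theorem lemma3p2:
  fixes X :: "'a topology"
  assumes "monotone_convergence_space X"
  shows "{V. openin (core_compactly_generated TYPE('a + 'c) X) V}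
           \<subseteq> {V. openin (scott_topology (topspace X) (specialization X)) V}"
proof (intro subsetI CollectI)
  fix V
  assume "V \<in> {V. openin (core_compactly_generated TYPE('a + 'c) X) V}"
  then have V: "core_compactly_generated_open TYPE('a + 'c) X V"
    by (simp add: openin_core_compactly_generated)
  have "scott_open (topspace X) (specialization X) V"
    unfolding scott_open_def
  proof (intro conjI ballI allI impI)
    show "V \<subseteq> topspace X"
      using V by (simp add: core_compactly_generated_open_def)
  next
    fix x y
    assume "x \<in> V" "specialization X x y"
    then show "y \<in> V"
      using core_compactly_generated_open_upper[OF V] by blast
  next
    fix D s
    assume "D \<subseteq> topspace X \<and> directed_set (specialization X) D \<and>
      is_supremum (topspace X) (specialization X) D s \<and> s \<in> V"
    then have D: "D \<subseteq> topspace X" and dir: "directed_set (specialization X) D"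
      and sup: "is_supremum (topspace X) (specialization X) D s" and "s \<in> V"
      by auto
    have "adjoin_top_open (specialization X) D (undefined :: 'c)
        {c \<in> insert (Inr undefined) (Inl ` D). case_sum id (\<lambda>_. s) c \<in> V}"
      using sup supremum_in_closure_of[OF assms D dir sup]
      by (intro adjoin_top_open_vimage[OF V dir D]) (auto simp: is_supremum_def)
    \<comment> \<open>As \<open>s\<close> is in \<open>V\<close>, the preimage contains the new
      point, and the last clause yields some \<open>Inl d\<close> in it, with \<open>d\<close> in
      both \<open>D\<close> and \<open>V\<close>.\<close>
    then show "D \<inter> V \<noteq> {}"
      using \<open>s \<in> V\<close> unfolding adjoin_top_open_def by force
  qed
  then show "openin (scott_topology (topspace X) (specialization X)) V"
    by (simp add: openin_scott_topology)
qed

end
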